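(* Let $\kappa$ be a cardinal. The following are equivalent: (a) $\Delta(A(\kappa))$ holds; (b) $\nabla A(\kappa)^\omega$ is monotonically normal; (c) $\nabla^*A(\kappa)$ is monotonically normal; (d) $\nabla A(\kappa)^\omega$ is halvable.
   Context: $D(\kappa)$ is the discrete space of size $\kappa$ (with underlying set $\kappa$). $A(\kappa)$ is its one-point compactification: the set $D(\kappa)\cup\{\kappa\}$, points of $D(\kappa)$ isolated, and basic neighborhoods of the point $\kappa$ of the form $\{\kappa\}\cup(D(\kappa)\setminus C)$ with $C$ finite. $\nabla A(\kappa)^\omega$: the box product $\square A(\kappa)^\omega$ is $A(\kappa)^\omega$ with base all $\prod_nU_n$, $U_n$ open; $x\sim y$ iff $\{n:x(n)\neq y(n)\}$ is finite; $\nabla A(\kappa)^\omega=\square A(\kappa)^\omega/\sim$ with the quotient topology. $D(\kappa)^{\subseteq\omega}$ is the set of partial functions from $\omega$ to $D(\kappa)$ (identified with their graphs) and $D(\kappa)^{\subset\omega}$ the subset of those with infinite and co-infinite domain. For $x\in D(\kappa)^{\subseteq\omega}$, $\overline{x}\in\nabla A(\kappa)^\omega$ is the class of the total function extending $x$ with value the point $\kappa$ outside $\operatorname{dom}x$. $\nabla^*A(\kappa)=\{\overline{x}:x\in D(\kappa)^{\subset\omega}\}$, a subspace of $\nabla A(\kappa)^\omega$. $x,y\in D(\kappa)^{\subseteq\omega}$ switch if $x\setminus y$ and $y\setminus x$ are infinite and $\{n\in\operatorname{dom}x\cap\operatorname{dom}y: x(n)\neq y(n)\}$ is finite. $\Delta(A(\kappa))$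 is the statement: there is $F:D(\kappa)^{\subset\omega}\to([\kappa]^{<\omega})^\omega$ such that if $x,y\in D(\kappa)^{\subset\omega}$ switch, then for infinitely many $n\in\omega$: ($n\in\operatorname{dom}(x\setminus y)$ and $(x\setminus y)(n)\in F(y)(n)$) or ($n\in\operatorname{dom}(y\setminus x)$ and $(y\setminus x)(n)\in F(x)(n)$). A space is monotonically normal if to every point $x$ and open $U\ni x$ there is assigned an open $G(x,U)$ with $x\in G(x,U)\subseteq U$ such that $G(x,U)\cap G(y,V)\neq\emptyset$ implies $x\in V$ or $y\in U$. A neighbornet on a space assigns to each point a neighborhood of it; a space is halvable if for every neighbornet $T$ there is a neighbornet $S$ such that $S(x)\cap S(y)\ne\emptyset$ implies $x\in T(y)$ or $y\in T(x)$. *)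

theory Defs
  imports "HOL-Analysis.Analysis"
begin

text \<open>
  A cardinal is represented by an arbitrary set \<open>K\<close> of that size, over an arbitrary type.  So
  \<open>D(\<kappa>)\<close> is \<open>discrete_topology K\<close>, and in \<open>A(\<kappa>)\<close> a point \<open>a\<close> of \<open>D(\<kappa>)\<close> becomes \<open>Some a\<close>
  while the added point \<open>\<kappa>\<close> becomes \<open>None\<close>.
\<close>

definition A_space :: "'a set \<Rightarrow> 'a option topology" where
  "A_space K = Alexandroff_compactification (discrete_topology K)"

lemma topspace_A_space [simp]: "topspace (A_space K) = insert None (Some ` K)"
  by (simp add: A_space_def)

lemma openin_A_space:
  "openin (A_space K) V \<longleftrightarrow>
    (\<exists>U\<subseteq>K. V = Some ` U) \<or> (\<exists>C\<subseteq>K. finite C \<and> V = insert None (Some ` (K - C)))"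
  by (auto simp: A_space_def openin_Alexandroff_compactification compactin_discrete_topology)


definition box_power :: "'b topology \<Rightarrow> (nat \<Rightarrow> 'b) topology" where
  "box_power X = topology_generated_by {PiE UNIV U | U. \<forall>n. openin X (U n)}"

lemma topspace_box_power: "topspace (box_power X) = PiE UNIV (\<lambda>n. topspace X)"
proof -
  have "PiE UNIV (\<lambda>n. topspace X) \<in> {PiE UNIV U | U. \<forall>n. openin X (U n)}"
    by blast
  moreover have "B \<subseteq> PiE UNIV (\<lambda>n. topspace X)"
    if "B \<in> {PiE UNIV U | U. \<forall>n. openin X (U n)}" for B
    using that by (auto simp: PiE_def Pi_def dest: openin_subset)
  ultimately show ?thesis
    unfolding box_power_def topology_generated_by_topspace
    by (intro subset_antisym Union_least Union_upper)
qed

text \<open>The boxes are closed under finite intersections, so they form a base of \<open>box_power X\<close>.\<close>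

lemma openin_box_power:
  "openin (box_power X) W \<longleftrightarrow>
    (\<forall>x\<in>W. \<exists>U. (\<forall>n. openin X (U n)) \<and> x \<in> PiE UNIV U \<and> PiE UNIV U \<subseteq> W)"
    (is "_ \<longleftrightarrow> ?R W")
proof
  let ?B = "{PiE UNIV U | U. \<forall>n. openin X (U n)}"
  assume "openin (box_power X) W"
  then have "generate_topology_on ?B W"
    by (simp add: box_power_def openin_topology_generated_by_iff)
  then show "?R W"
  proof (induction rule: generate_topology_on.induct)
    case Empty
    then show ?case by simp
  next
    case (Int V W)
    show ?case
    proof
      fix x assume "x \<in> V \<inter> W"
      then have "x \<in> V" "x \<in> W"
        by simp_all
      obtain U where U: "\<forall>n. openin X (U n)" "x \<in> PiE UNIV U" "PiE UNIV U \<subseteq> V"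
        using bspec[OF Int.IH(1) \<open>x \<in> V\<close>] by (elim exE conjE)
      obtain U' where U': "\<forall>n. openin X (U' n)" "x \<in> PiE UNIV U'" "PiE UNIV U' \<subseteq> W"
        using bspec[OF Int.IH(2) \<open>x \<in> W\<close>] by (elim exE conjE)
      have "PiE UNIV (\<lambda>n. U n \<inter> U' n) = PiE UNIV U \<inter> PiE UNIV U'"
        by (simp add: PiE_Int)
      then have "x \<in> PiE UNIV (\<lambda>n. U n \<inter> U' n)" "PiE UNIV (\<lambda>n. U n \<inter> U' n) \<subseteq> V \<inter> W"
        using U(2,3) U'(2,3) by blast+
      moreover have "\<forall>n. openin X (U n \<inter> U' n)"
        using U(1) U'(1) by (simp add: openin_Int)
      ultimately show "\<exists>U. (\<forall>n. openin X (U n)) \<and> x \<in> PiE UNIV U \<and> PiE UNIV U \<subseteq> V \<inter> W"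
        by (intro exI[of _ "\<lambda>n. U n \<inter> U' n"] conjI)
    qed
  next
    case (UN \<W>)
    show ?case
    proof
      fix x assume "x \<in> \<Union>\<W>"
      then obtain V where V: "V \<in> \<W>" "x \<in> V"
        by blast
      obtain U where U: "\<forall>n. openin X (U n)" "x \<in> PiE UNIV U" "PiE UNIV U \<subseteq> V"
        using bspec[OF UN.IH[OF V(1)] V(2)] by (elim exE conjE)
      have "PiE UNIV U \<subseteq> \<Union>\<W>"
        using U(3) V(1) by (rule order_trans[OF _ Union_upper])
      with U show "\<exists>U. (\<forall>n. openin X (U n)) \<and> x \<in> PiE UNIV U \<and> PiE UNIV U \<subseteq> \<Union>\<W>"
        by (intro exI[of _ U] conjI)
    qed
  next
    case (Basis B)
    then obtain U where U: "B = PiE UNIV U" "\<forall>n. openin X (U n)"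
      by blast
    show ?case
      by (intro ballI exI[of _ U] conjI) (simp_all add: U)
  qed
next
  assume R: "?R W"
  have "openin (box_power X) (PiE UNIV U)" if "\<forall>n. openin X (U n)" for U
    unfolding box_power_def by (rule topology_generated_by_Basis) (use that in blast)
  then show "openin (box_power X) W"
    using R by (subst openin_subopen) meson
qed


text \<open>The quotient of \<open>X\<close> by a relation \<open>R\<close>; its points are the classes \<open>R `` {x}\<close>.\<close>

definition quotient_topology :: "'b topology \<Rightarrow> ('b \<times> 'b) set \<Rightarrow> 'b set topology" where
  "quotient_topology X R =
    topology (\<lambda>W. W \<subseteq> topspace X // R \<and> openin X {x \<in> topspace X. R `` {x} \<in> W})"

lemma openin_quotient_topology:
  "openin (quotient_topology X R) W \<longleftrightarrow>
    W \<subseteq> topspace X // R \<and> openin X {x \<in> topspace X. R `` {x} \<in> W}"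
proof -
  have "istopology (\<lambda>W. W \<subseteq> topspace X // R \<and> openin X {x \<in> topspace X. R `` {x} \<in> W})"
    (is "istopology ?P")
    unfolding istopology_def
  proof (intro conjI allI impI)
    fix S T assume S: "?P S" and T: "?P T"
    have "{x \<in> topspace X. R `` {x} \<in> S \<inter> T} =
        {x \<in> topspace X. R `` {x} \<in> S} \<inter> {x \<in> topspace X. R `` {x} \<in> T}"
      by blast
    with S T show "openin X {x \<in> topspace X. R `` {x} \<in> S \<inter> T}"
      by (simp only: openin_Int)
    from S show "S \<inter> T \<subseteq> topspace X // R"
      by blast
  next
    fix \<K> assume K: "\<forall>S\<in>\<K>. ?P S"
    have "{x \<in> topspace X. R `` {x} \<in> \<Union>\<K>} = (\<Union>S\<in>\<K>. {x \<in> topspace X. R `` {x} \<in> S})"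
      by blast
    with K show "openin X {x \<in> topspace X. R `` {x} \<in> \<Union>\<K>}"
      by auto
    from K show "\<Union>\<K> \<subseteq> topspace X // R"
      by blast
  qed
  then show ?thesis
    by (simp add: quotient_topology_def)
qed

lemma topspace_quotient_topology: "topspace (quotient_topology X R) = topspace X // R"
proof -
  have "{x \<in> topspace X. R `` {x} \<in> topspace X // R} = topspace X"
    by (auto intro: quotientI)
  then have "openin (quotient_topology X R) (topspace X // R)"
    by (simp add: openin_quotient_topology)
  then show ?thesis
    by (metis openin_quotient_topology openin_subset openin_topspace subset_antisym)
qed

lemma quotient_map_quotient_topology:
  "quotient_map X (quotient_topology X R) (\<lambda>x. R `` {x})"
  by (auto simp: quotient_map_def topspace_quotient_topology openin_quotient_topology
      quotient_def)


definition eq_mod_finite :: "'b set \<Rightarrow> ((nat \<Rightarrow> 'b) \<times> (nat \<Rightarrow> 'b)) set" where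
  "eq_mod_finite S = {(x, y). x \<in> PiE UNIV (\<lambda>n. S) \<and> y \<in> PiE UNIV (\<lambda>n. S) \<and>
    finite {n. x n \<noteq> y n}}"

lemma equiv_eq_mod_finite: "equiv (PiE UNIV (\<lambda>n. S)) (eq_mod_finite S)"
proof (rule equivI)
  show "refl_on (PiE UNIV (\<lambda>n. S)) (eq_mod_finite S)"
    by (auto simp: refl_on_def eq_mod_finite_def)
  show "sym (eq_mod_finite S)"
    by (auto simp: sym_def eq_mod_finite_def eq_commute)
  show "trans (eq_mod_finite S)"
  proof (rule transI)
    fix x y z assume xy: "(x, y) \<in> eq_mod_finite S" and yz: "(y, z) \<in> eq_mod_finite S"
    have "{n. x n \<noteq> z n} \<subseteq> {n. x n \<noteq> y n} \<union> {n. y n \<noteq> z n}"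
      by auto
    with xy yz show "(x, z) \<in> eq_mod_finite S"
      by (auto simp: eq_mod_finite_def intro: finite_subset)
  qed
qed (auto simp: eq_mod_finite_def)

definition nabla_space :: "'b topology \<Rightarrow> (nat \<Rightarrow> 'b) set topology" where
  "nabla_space X = quotient_topology (box_power X) (eq_mod_finite (topspace X))"


definition partial_funs :: "'a set \<Rightarrow> (nat \<rightharpoonup> 'a) set" where
  "partial_funs K = {x. ran x \<subseteq> K}"

definition proper_partial_funs :: "'a set \<Rightarrow> (nat \<rightharpoonup> 'a) set" where
  "proper_partial_funs K = {x \<in> partial_funs K. infinite (dom x) \<and> infinite (- dom x)}"

text \<open>
  A map \<open>nat \<rightharpoonup> 'a\<close> is a total function to \<open>'a option\<close> that is \<open>None\<close> outside its domain.  As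
  \<open>None\<close> is also the added point of \<open>A_space K\<close>, such a map, read as a point of the box product,
  already is its own extension by the added point.
\<close>

definition bar :: "'a set \<Rightarrow> (nat \<rightharpoonup> 'a) \<Rightarrow> (nat \<Rightarrow> 'a option) set" where
  "bar K x = eq_mod_finite (topspace (A_space K)) `` {x}"

definition nabla_star :: "'a set \<Rightarrow> (nat \<Rightarrow> 'a option) set topology" where
  "nabla_star K = subtopology (nabla_space (A_space K)) (bar K ` proper_partial_funs K)"

lemma topspace_nabla_star: "topspace (nabla_star K) = bar K ` proper_partial_funs K"
proof -
  have "x \<in> topspace (box_power (A_space K))" if "x \<in> proper_partial_funs K" for x
  proof -
    have "x n \<in> insert None (Some ` K)" for n
      using that by (cases "x n") (auto simp: proper_partial_funs_def partial_funs_def ran_def)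
    then show ?thesis
      by (auto simp: topspace_box_power)
  qed
  then have "bar K ` proper_partial_funs K \<subseteq> topspace (nabla_space (A_space K))"
    unfolding nabla_space_def topspace_quotient_topology bar_def by (auto intro: quotientI)
  then show ?thesis
    by (auto simp: nabla_star_def)
qed


definition switch :: "(nat \<rightharpoonup> 'a) \<Rightarrow> (nat \<rightharpoonup> 'a) \<Rightarrow> bool" where
  "switch x y \<longleftrightarrow> infinite (Map.graph x - Map.graph y) \<and> infinite (Map.graph y - Map.graph x) \<and>
    finite {n \<in> dom x \<inter> dom y. x n \<noteq> y n}"

definition Delta_A :: "'a set \<Rightarrow> bool" where
  "Delta_A K \<longleftrightarrow>
    (\<exists>F \<in> proper_partial_funs K \<rightarrow> (UNIV \<rightarrow> Fpow K).
      \<forall>x \<in> proper_partial_funs K. \<forall>y \<in> proper_partial_funs K. switch x y \<longrightarrow>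
        infinite {n. (\<exists>a. (n, a) \<in> Map.graph x - Map.graph y \<and> a \<in> F y n) \<or>
                     (\<exists>a. (n, a) \<in> Map.graph y - Map.graph x \<and> a \<in> F x n)})"


definition monotonically_normal :: "'b topology \<Rightarrow> bool" where
  "monotonically_normal X \<longleftrightarrow>
    (\<exists>G. (\<forall>x U. openin X U \<and> x \<in> U \<longrightarrow> openin X (G x U) \<and> x \<in> G x U \<and> G x U \<subseteq> U) \<and>
      (\<forall>x U y V. openin X U \<and> x \<in> U \<and> openin X V \<and> y \<in> V \<and> G x U \<inter> G y V \<noteq> {} \<longrightarrow>
        x \<in> V \<or> y \<in> U))"

text \<open>Neighbourhoods are not required to be open.\<close>

definition neighbornet :: "'b topology \<Rightarrow> ('b \<Rightarrow> 'b set) \<Rightarrow> bool" where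
  "neighbornet X T \<longleftrightarrow>
    (\<forall>x \<in> topspace X. T x \<subseteq> topspace X \<and> (\<exists>U. openin X U \<and> x \<in> U \<and> U \<subseteq> T x))"

definition halvable :: "'b topology \<Rightarrow> bool" where
  "halvable X \<longleftrightarrow>
    (\<forall>T. neighbornet X T \<longrightarrow>
      (\<exists>S. neighbornet X S \<and>
        (\<forall>x \<in> topspace X. \<forall>y \<in> topspace X. S x \<inter> S y \<noteq> {} \<longrightarrow> x \<in> T y \<or> y \<in> T x)))"

end

theory Submission
  imports Defs
begin

text \<open>
  The class of \<open>x\<close> has the basic neighbourhoods \<open>N x F\<close>, for sequences \<open>F\<close> of finite sets, of all
  classes of \<open>z\<close> that extend \<open>x\<close> and avoid \<open>F n\<close> at every \<open>n\<close> outside \<open>dom x\<close>, up to finitely many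
  \<open>n\<close>.  If \<open>N x F\<close> meets \<open>N y H\<close>, then \<open>x\<close> and \<open>y\<close> are compatible up to finitely many \<open>n\<close>; if
  moreover \<open>x - y\<close> is finite, then \<open>y\<close> already lies in \<open>N x F\<close>.  So monotone normality can only fail
  at pairs that switch, and enlarging the sequences by the function given by \<open>\<Delta>\<close> makes the
  neighbourhoods of such pairs disjoint.  Conversely, switching points lie outside the
  neighbourhoods \<open>N x \<emptyset>\<close> and \<open>N y \<emptyset>\<close> of each other, so halving that neighbornet yields \<open>\<Delta>\<close>:
  otherwise \<open>x \<union> y\<close> would lie in both halved neighbourhoods.  To have \<open>x \<union> y\<close> in the subspace
  \<open>\<nabla>\<^sup>*\<close> as well, \<open>x\<close> and \<open>y\<close> are first spread out over the even numbers.
\<close>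

section \<open>Basic neighbourhoods in the nabla product\<close>

text \<open>\<open>None\<close> means both "undefined" and the added point, so partial functions are
  literally the points of the box product and every class is some \<open>bar K x\<close>.\<close>

lemma partial_funs_eq_PiE: "partial_funs K = PiE UNIV (\<lambda>n. topspace (A_space K))"
proof -
  have "ran x \<subseteq> K \<longleftrightarrow> (\<forall>n. x n \<in> insert None (Some ` K))" for x :: "nat \<rightharpoonup> 'a"
  proof
    assume "ran x \<subseteq> K"
    then show "\<forall>n. x n \<in> insert None (Some ` K)"
      by (metis imageI insertCI not_None_eq ranI subsetD)
  next
    assume *: "\<forall>n. x n \<in> insert None (Some ` K)"
    show "ran x \<subseteq> K"
    proof
      fix a assume "a \<in> ran x"
      then obtain n where "x n = Some a"
        by (auto simp: ran_def)
      with *[rule_format, of n] show "a \<in> K"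
        by auto
    qed
  qed
  then show ?thesis
    by (auto simp: partial_funs_def)
qed

lemma bar_eq_iff:
  assumes "x \<in> partial_funs K" "y \<in> partial_funs K"
  shows "bar K x = bar K y \<longleftrightarrow> (MOST n. x n = y n)"
proof -
  have "bar K x = bar K y \<longleftrightarrow> (x, y) \<in> eq_mod_finite (topspace (A_space K))"
    unfolding bar_def
    using assms by (intro eq_equiv_class_iff[OF equiv_eq_mod_finite])
      (simp_all only: partial_funs_eq_PiE)
  also have "\<dots> \<longleftrightarrow> (MOST n. x n = y n)"
    using assms unfolding eq_mod_finite_def partial_funs_eq_PiE by (simp add: MOST_iff_finiteNeg)
  finally show ?thesis .
qed

lemma topspace_nabla: "topspace (nabla_space (A_space K)) = bar K ` partial_funs K"
  by (auto simp: nabla_space_def topspace_quotient_topology topspace_box_power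
      partial_funs_eq_PiE bar_def quotient_def)

lemma proper_partial_funs_subset: "proper_partial_funs K \<subseteq> partial_funs K"
  by (auto simp: proper_partial_funs_def)

text \<open>A set of classes is open when its preimage is, so a box is required around every
  representative of a class, not around a chosen one.\<close>

lemma openin_nabla:
  "openin (nabla_space (A_space K)) W \<longleftrightarrow>
    W \<subseteq> bar K ` partial_funs K \<and>
    (\<forall>x\<in>partial_funs K. bar K x \<in> W \<longrightarrow>
      (\<exists>U. (\<forall>n. openin (A_space K) (U n)) \<and> x \<in> PiE UNIV U \<and>
        (\<forall>z\<in>PiE UNIV U. z \<in> partial_funs K \<and> bar K z \<in> W)))"
proof -
  have 1: "topspace (box_power (A_space K)) // eq_mod_finite (topspace (A_space K))
      = bar K ` partial_funs K"
    using topspace_nabla[of K] by (simp add: nabla_space_def topspace_quotient_topology)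
  have 2: "topspace (box_power (A_space K)) = partial_funs K"
    by (simp only: topspace_box_power partial_funs_eq_PiE)
  show ?thesis
    unfolding nabla_space_def openin_quotient_topology 1 unfolding 2 openin_box_power bar_def
    by (intro conj_cong refl) (simp add: subset_iff Ball_def imp_conjL)
qed

section \<open>Nearness and basic neighbourhoods\<close>

definition near :: "(nat \<rightharpoonup> 'a) \<Rightarrow> (nat \<Rightarrow> 'a set) \<Rightarrow> (nat \<rightharpoonup> 'a) \<Rightarrow> bool" where
  "near x F z \<longleftrightarrow> (MOST n. case x n of Some a \<Rightarrow> z n = Some a | None \<Rightarrow> z n \<notin> Some ` F n)"

definition nbhd :: "'a set \<Rightarrow> (nat \<rightharpoonup> 'a) \<Rightarrow> (nat \<Rightarrow> 'a set) \<Rightarrow> (nat \<Rightarrow> 'a option) set set" where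
  "nbhd K x F = bar K ` {z \<in> partial_funs K. near x F z}"

lemma near_cong:
  assumes "MOST n. z n = w n"
  shows "near x F z \<longleftrightarrow> near x F w"
  unfolding near_def
  by (rule eventually_cong[OF assms]) (simp split: option.split)

lemma near_refl: "near x F x"
  by (auto simp: near_def split: option.split)

text \<open>For almost all \<open>n\<close> outside \<open>dom x\<close> but inside
  \<open>dom y\<close>, \<open>z n\<close> equals \<open>y n\<close>, which already avoids
  \<open>F n\<close>. This is what makes \<open>nbhd K x F\<close> open.\<close>

lemma near_trans:
  assumes "near x F y" "near y F z"
  shows "near x F z"
  using assms unfolding near_def
  by (eventually_elim) (auto split: option.splits)

lemma near_mono:
  assumes "near x F z" "\<And>n. H n \<subseteq> F n"
  shows "near x H z"
  using assms(1) unfolding near_def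
  by (rule eventually_mono) (use assms(2) in \<open>auto split: option.splits\<close>)

lemma bar_mem_nbhd:
  assumes "z \<in> partial_funs K"
  shows "bar K z \<in> nbhd K x F \<longleftrightarrow> near x F z"
proof
  assume "bar K z \<in> nbhd K x F"
  then obtain w where "w \<in> partial_funs K" "near x F w" "bar K z = bar K w"
    by (auto simp: nbhd_def)
  with assms show "near x F z"
    using bar_eq_iff near_cong by metis
qed (use assms in \<open>auto simp: nbhd_def\<close>)

lemma openin_nbhd:
  assumes "\<And>n. finite (F n)"
  shows "openin (nabla_space (A_space K)) (nbhd K x F)"
  unfolding openin_nabla
proof (intro conjI ballI impI)
  show "nbhd K x F \<subseteq> bar K ` partial_funs K"
    by (auto simp: nbhd_def)
next
  fix z assume z: "z \<in> partial_funs K" "bar K z \<in> nbhd K x F"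
  then have near: "near x F z"
    by (simp add: bar_mem_nbhd)
  \<comment> \<open>A box around \<open>z\<close>: singletons on \<open>dom z\<close>, cofinite
    neighbourhoods of the added point elsewhere. Its points are near \<open>z\<close>, hence near
    \<open>x\<close> by transitivity.\<close>
  define U where "U n = (case z n of Some a \<Rightarrow> {Some a} | None \<Rightarrow> insert None (Some ` (K - F n)))" for n
  have zn: "z n \<in> insert None (Some ` K)" for n
    using z(1) unfolding partial_funs_eq_PiE by auto
  have U: "openin (A_space K) (U n)" for n
  proof (cases "z n")
    case None
    \<comment> \<open>\<open>F n\<close> may stick out of \<open>K\<close>; only its part inside
      \<open>K\<close> is removed.\<close>
    have "insert None (Some ` (K - F n)) = insert None (Some ` (K - K \<inter> F n))"
      by auto
    then show ?thesis
      unfolding openin_A_space U_def using None assms[of n]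
      by (intro disjI2 exI[of _ "K \<inter> F n"]) simp
  next
    case (Some a)
    then show ?thesis
      unfolding openin_A_space U_def using zn[of n]
      by (intro disjI1 exI[of _ "{a}"]) auto
  qed
  show "\<exists>U. (\<forall>n. openin (A_space K) (U n)) \<and> z \<in> PiE UNIV U \<and>
        (\<forall>w\<in>PiE UNIV U. w \<in> partial_funs K \<and> bar K w \<in> nbhd K x F)"
  proof (intro exI[of _ U] conjI ballI allI U)
    show "z \<in> PiE UNIV U"
      by (auto simp: U_def split: option.split)
    fix w assume w: "w \<in> PiE UNIV U"
    show *: "w \<in> partial_funs K"
      using w U openin_subset unfolding partial_funs_eq_PiE by fast
    have "case z n of Some a \<Rightarrow> w n = Some a | None \<Rightarrow> w n \<notin> Some ` F n" for n
    proof -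
      have "w n \<in> U n"
        using w by auto
      then show ?thesis
        by (auto simp: U_def split: option.splits)
    qed
    then have "near z F w"
      by (simp add: near_def)
    then show "bar K w \<in> nbhd K x F"
      using near * near_trans bar_mem_nbhd by metis
  qed
qed

lemma nbhd_base:
  assumes "openin (nabla_space (A_space K)) W" "x \<in> partial_funs K" "bar K x \<in> W"
  shows "\<exists>F. (\<forall>n. F n \<in> Fpow K) \<and> nbhd K x F \<subseteq> W"
proof -
  obtain U where U: "\<And>n. openin (A_space K) (U n)" "x \<in> PiE UNIV U"
    "\<And>z. z \<in> PiE UNIV U \<Longrightarrow> z \<in> partial_funs K \<and> bar K z \<in> W"
    using assms unfolding openin_nabla by metis
  \<comment> \<open>\<open>F n\<close> is the finite set of points that \<open>U n\<close> misses.
    If \<open>None\<close> is not in \<open>U n\<close>, then \<open>n\<close> lies in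
    \<open>dom x\<close> and \<open>F n\<close> has no influence, so the default is empty.\<close>
  define F where "F n = (if None \<in> U n then {a \<in> K. Some a \<notin> U n} else {})" for n
  have "F n \<in> Fpow K" for n
  proof (cases "None \<in> U n")
    case True
    with U(1)[of n] obtain C where C: "finite C" "U n = insert None (Some ` (K - C))"
      unfolding openin_A_space by auto
    then have "F n \<subseteq> C"
      by (auto simp: F_def)
    then have "finite (F n)"
      using C(1) by (rule finite_subset)
    then show ?thesis
      by (auto simp: F_def Fpow_def)
  qed (simp add: F_def Fpow_def)
  moreover have "nbhd K x F \<subseteq> W"
  proof
    fix c assume "c \<in> nbhd K x F"
    then obtain z where z: "z \<in> partial_funs K" "near x F z" "c = bar K z"
      by (auto simp: nbhd_def)
    \<comment> \<open>\<open>z\<close> may leave the box at finitely many \<open>n\<close>;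
      replacing its values there by those of \<open>x\<close> gives a point of the box in the same
      class.\<close>
    define w where "w n = (if z n \<in> U n then z n else x n)" for n
    have xU: "x n \<in> U n" for n
      using U(2) by auto
    have "w \<in> PiE UNIV U"
      using xU by (auto simp: w_def)
    then have w: "w \<in> partial_funs K" "bar K w \<in> W"
      using U(3) by auto
    have zn: "z n \<in> insert None (Some ` K)" for n
      using z(1) unfolding partial_funs_eq_PiE by auto
    have "MOST n. z n = w n"
      using z(2) unfolding near_def
    proof (rule eventually_mono)
      fix n assume "case x n of Some a \<Rightarrow> z n = Some a | None \<Rightarrow> z n \<notin> Some ` F n"
      then have "z n \<in> U n"
        using xU[of n] zn[of n] by (auto simp: F_def split: option.splits)
      then show "z n = w n"
        by (simp add: w_def)
    qed
    then show "c \<in> W"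
      using w z bar_eq_iff by metis
  qed
  ultimately show ?thesis
    by blast
qed

text \<open>Projecting a graph to its domain is injective, so the graph difference of
  \<open>u\<close> and \<open>v\<close> is finite iff \<open>v\<close> agrees with \<open>u\<close>
  almost everywhere on \<open>dom u\<close>, which is nearness with empty sets.\<close>

lemma switch_iff:
  "switch x y \<longleftrightarrow> \<not> near x (\<lambda>_. {}) y \<and> \<not> near y (\<lambda>_. {}) x \<and>
    (MOST n. n \<in> dom x \<inter> dom y \<longrightarrow> x n = y n)"
proof -
  have "finite (Map.graph u - Map.graph v) \<longleftrightarrow> near u (\<lambda>_. {}) v" for u v :: "nat \<rightharpoonup> 'a"
  proof -
    let ?B = "{n. \<not> (case u n of Some a \<Rightarrow> v n = Some a | None \<Rightarrow> v n \<notin> Some ` {})}"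
    have B: "?B = fst ` (Map.graph u - Map.graph v)"
      by (force simp: Map.graph_def image_iff split: option.splits)
    have "inj_on fst (Map.graph u - Map.graph v)"
      by (auto simp: Map.graph_def inj_on_def)
    from finite_image_iff[OF this] show ?thesis
      unfolding near_def MOST_iff_finiteNeg B by simp
  qed
  moreover have "finite {n \<in> dom x \<inter> dom y. x n \<noteq> y n} \<longleftrightarrow>
      (MOST n. n \<in> dom x \<inter> dom y \<longrightarrow> x n = y n)"
    unfolding MOST_iff_finiteNeg by (rule arg_cong[of _ _ finite]) auto
  ultimately show ?thesis
    unfolding switch_def by simp
qed

section \<open>Monotone normality and halvability\<close>

text \<open>Extend each relatively open \<open>U\<close> to an open \<open>E U\<close>, apply
  \<open>G\<close> there and restrict. Points of \<open>S\<close> in \<open>E U\<close> lie in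
  \<open>U\<close>, so separation carries over.\<close>

lemma monotonically_normal_subtopology:
  assumes "monotonically_normal X"
  shows "monotonically_normal (subtopology X S)"
proof -
  obtain G where
    G: "\<And>x U. openin X U \<Longrightarrow> x \<in> U \<Longrightarrow> openin X (G x U) \<and> x \<in> G x U \<and> G x U \<subseteq> U" and
    sep: "\<And>x U y V. openin X U \<Longrightarrow> x \<in> U \<Longrightarrow> openin X V \<Longrightarrow> y \<in> V \<Longrightarrow>
      G x U \<inter> G y V \<noteq> {} \<Longrightarrow> x \<in> V \<or> y \<in> U"
    using assms unfolding monotonically_normal_def by metis
  obtain E where E: "\<And>U. openin (subtopology X S) U \<Longrightarrow> openin X (E U) \<and> U = E U \<inter> S"
    using openin_subtopology[of X S] by metis
  show ?thesis
    unfolding monotonically_normal_def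
  proof (intro exI[of _ "\<lambda>x U. G x (E U) \<inter> S"] conjI allI impI; elim conjE)
    fix x U assume U: "openin (subtopology X S) U" "x \<in> U"
    then have x: "x \<in> E U" "x \<in> S"
      using E by blast+
    note GE = G[OF conjunct1[OF E[OF U(1)]] x(1)]
    show "openin (subtopology X S) (G x (E U) \<inter> S)"
      using GE by (simp add: openin_subtopology_Int)
    show "x \<in> G x (E U) \<inter> S" "G x (E U) \<inter> S \<subseteq> U"
      using GE E[OF U(1)] x by blast+
  next
    fix x U y V
    assume "openin (subtopology X S) U" "x \<in> U" "openin (subtopology X S) V" "y \<in> V"
      "G x (E U) \<inter> S \<inter> (G y (E V) \<inter> S) \<noteq> {}"
    with E[of U] E[of V] sep[of "E U" x "E V" y] show "x \<in> V \<or> y \<in> U"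
      by blast
  qed
qed

text \<open>With open \<open>U x\<close> inside \<open>T x\<close>, the sets
  \<open>G x (U x)\<close> halve \<open>T\<close>.\<close>

lemma monotonically_normal_imp_halvable:
  assumes "monotonically_normal X"
  shows "halvable X"
  unfolding halvable_def
proof (intro allI impI)
  obtain G where
    G: "\<And>x U. openin X U \<Longrightarrow> x \<in> U \<Longrightarrow> openin X (G x U) \<and> x \<in> G x U \<and> G x U \<subseteq> U" and
    sep: "\<And>x U y V. openin X U \<Longrightarrow> x \<in> U \<Longrightarrow> openin X V \<Longrightarrow> y \<in> V \<Longrightarrow>
      G x U \<inter> G y V \<noteq> {} \<Longrightarrow> x \<in> V \<or> y \<in> U"
    using assms unfolding monotonically_normal_def by metis
  fix T assume "neighbornet X T"
  then obtain U where U: "\<And>x. x \<in> topspace X \<Longrightarrow> openin X (U x) \<and> x \<in> U x \<and> U x \<subseteq> T x"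
    unfolding neighbornet_def by metis
  show "\<exists>S. neighbornet X S \<and>
      (\<forall>x\<in>topspace X. \<forall>y\<in>topspace X. S x \<inter> S y \<noteq> {} \<longrightarrow> x \<in> T y \<or> y \<in> T x)"
  proof (intro exI[of _ "\<lambda>x. G x (U x)"] conjI ballI impI)
    show "neighbornet X (\<lambda>x. G x (U x))"
      unfolding neighbornet_def using U G openin_subset by (metis subset_refl)
    fix x y assume "x \<in> topspace X" "y \<in> topspace X" "G x (U x) \<inter> G y (U y) \<noteq> {}"
    with U[of x] U[of y] sep[of "U x" x "U y" y] show "x \<in> T y \<or> y \<in> T x"
      by blast
  qed
qed

section \<open>The equivalence\<close>

lemma Delta_A_imp_monotonically_normal:
  assumes "Delta_A K"
  shows "monotonically_normal (nabla_space (A_space K))"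
proof -
  obtain D where D: "D \<in> proper_partial_funs K \<rightarrow> (UNIV \<rightarrow> Fpow K)" and
    Dsw: "\<forall>x\<in>proper_partial_funs K. \<forall>y\<in>proper_partial_funs K. switch x y \<longrightarrow>
        infinite {n. (\<exists>a. (n, a) \<in> Map.graph x - Map.graph y \<and> a \<in> D y n) \<or>
                     (\<exists>a. (n, a) \<in> Map.graph y - Map.graph x \<and> a \<in> D x n)}"
    using assms unfolding Delta_A_def by (elim bexE) (rule that)
  \<comment> \<open>\<open>D\<close> is controlled on proper functions only; the empty default keeps
    all values finite.\<close>
  define D' where "D' x n = (if x \<in> proper_partial_funs K then D x n else {})" for x n
  have finD: "finite (D' x n)" for x n
    using D by (auto simp: D'_def Fpow_def Pi_iff)
  \<comment> \<open>\<open>G\<close> acts on classes, while \<open>D\<close> depends on the function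
    itself, so one representative per class is fixed.\<close>
  obtain r where r: "\<And>c. c \<in> bar K ` partial_funs K \<Longrightarrow> r c \<in> partial_funs K \<and> bar K (r c) = c"
  proof
    show "inv_into (partial_funs K) (bar K) c \<in> partial_funs K \<and>
        bar K (inv_into (partial_funs K) (bar K) c) = c" if "c \<in> bar K ` partial_funs K" for c
      using that by (simp add: inv_into_into f_inv_into_f)
  qed
  let ?O = "openin (nabla_space (A_space K))"
  have rU: "r c \<in> partial_funs K \<and> bar K (r c) = c" if "?O U" "c \<in> U" for c U
    using that r openin_nabla[of K U] by blast
  obtain H where H: "\<And>c U. ?O U \<Longrightarrow> c \<in> U \<Longrightarrow> (\<forall>n. H c U n \<in> Fpow K) \<and> nbhd K (r c) (H c U) \<subseteq> U"
  proof -
    have "\<forall>c U. \<exists>F. ?O U \<longrightarrow> c \<in> U \<longrightarrow> (\<forall>n. F n \<in> Fpow K) \<and> nbhd K (r c) F \<subseteq> U"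
    proof (intro allI)
      fix c U
      show "\<exists>F. ?O U \<longrightarrow> c \<in> U \<longrightarrow> (\<forall>n. F n \<in> Fpow K) \<and> nbhd K (r c) F \<subseteq> U"
        using nbhd_base[of K U "r c"] rU[of U c] by auto
    qed
    then show ?thesis
      unfolding choice_iff using that by blast
  qed
  \<comment> \<open>\<open>H\<close> keeps the neighbourhood inside \<open>U\<close>;
    \<open>D'\<close> separates switching pairs.\<close>
  define M where "M c U n = H c U n \<union> D' (r c) n" for c U n
  have sub: "near x (H c U) z" "near x (D' (r c)) z" if "near x (M c U) z" for x c U z
    by (rule near_mono[OF that], simp add: M_def)+
  \<comment> \<open>At almost every \<open>n\<close> outside \<open>dom x\<close>,
    \<open>y n\<close> is either \<open>None\<close> or equal to \<open>z n\<close>, so it inherits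
    avoidance of \<open>F n\<close> from \<open>z\<close>.\<close>
  have interp: "near x F y" if "near x F z" "near y F' z" "near x (\<lambda>_. {}) y" for x y z F F'
    using that unfolding near_def by eventually_elim (auto split: option.splits)
  show ?thesis
    unfolding monotonically_normal_def
  proof (intro exI[of _ "\<lambda>c U. nbhd K (r c) (M c U)"] conjI allI impI; elim conjE)
    fix c U assume U: "?O U" "c \<in> U"
    have "finite (M c U n)" for n
      using H[OF U] finD by (auto simp: M_def Fpow_def)
    then show "?O (nbhd K (r c) (M c U))"
      by (rule openin_nbhd)
    show "c \<in> nbhd K (r c) (M c U)"
      using rU[OF U] bar_mem_nbhd near_refl by metis
    show "nbhd K (r c) (M c U) \<subseteq> U"
      using H[OF U] sub(1) unfolding nbhd_def by blast
  next
    fix c U d V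
    assume U: "?O U" "c \<in> U" and V: "?O V" "d \<in> V"
      and "nbhd K (r c) (M c U) \<inter> nbhd K (r d) (M d V) \<noteq> {}"
    then obtain e where e: "e \<in> nbhd K (r c) (M c U)" "e \<in> nbhd K (r d) (M d V)"
      by blast
    then obtain z where z: "z \<in> partial_funs K" "near (r c) (M c U) z" "e = bar K z"
      unfolding nbhd_def by blast
    have z': "near (r d) (M d V) z"
      using e(2) z by (simp add: bar_mem_nbhd)
    define x y where "x = r c" and "y = r d"
    have xy: "x \<in> partial_funs K" "bar K x = c" "y \<in> partial_funs K" "bar K y = d"
      using rU[OF U] rU[OF V] by (auto simp: x_def y_def)
    have zx: "near x (H c U) z" "near x (D' x) z" and zy: "near y (H d V) z" "near y (D' y) z"
      using z(2) z' sub unfolding x_def y_def by blast+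
    have compat: "MOST n. n \<in> dom x \<inter> dom y \<longrightarrow> x n = y n"
      using zx(2) zy(2) unfolding near_def by eventually_elim (auto split: option.splits)
    have "\<not> switch x y"
    proof
      assume sw: "switch x y"
      \<comment> \<open>Switching forces properness: a finite domain would make \<open>v\<close>
        near \<open>u\<close>, and a cofinite one, by compatibility, \<open>u\<close> near
        \<open>v\<close>.\<close>
      have proper: "u \<in> proper_partial_funs K"
        if "u \<in> partial_funs K" "\<not> near u (\<lambda>_. {}) v" "\<not> near v (\<lambda>_. {}) u"
          "MOST n. n \<in> dom u \<inter> dom v \<longrightarrow> u n = v n" for u v
      proof -
        have "infinite (dom u)"
        proof
          assume "finite (dom u)"
          then have "MOST n. n \<notin> dom u"
            by (simp add: MOST_iff_finiteNeg)
          then have "near u (\<lambda>_. {}) v"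
            unfolding near_def by eventually_elim (auto split: option.splits)
          with that show False by blast
        qed
        moreover have "infinite (- dom u)"
        proof
          assume "finite (- dom u)"
          then have "MOST n. n \<in> dom u"
            by (simp add: MOST_iff_finiteNeg Compl_eq)
          then have "near v (\<lambda>_. {}) u"
            using that(4) unfolding near_def by eventually_elim (auto split: option.splits)
          with that show False by blast
        qed
        ultimately show ?thesis
          using that(1) by (simp add: proper_partial_funs_def)
      qed
      have px: "x \<in> proper_partial_funs K"
        using proper[of x y] xy sw unfolding switch_iff by blast
      have py: "y \<in> proper_partial_funs K"
        using proper[of y x] xy sw unfolding switch_iff by (simp add: Int_commute eq_commute)
      \<comment> \<open>Almost everywhere, a value \<open>a\<close> of \<open>x\<close> not shared
        by \<open>y\<close> is the value of \<open>z\<close> at a point outside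
        \<open>dom y\<close>, where nearness to \<open>y\<close> keeps \<open>z\<close> out of
        \<open>D y n\<close>; likewise with the roles exchanged.\<close>
      have "MOST n. \<not> ((\<exists>a. (n, a) \<in> Map.graph x - Map.graph y \<and> a \<in> D y n) \<or>
                     (\<exists>a. (n, a) \<in> Map.graph y - Map.graph x \<and> a \<in> D x n))"
        using zx(2) zy(2) unfolding near_def
        by eventually_elim (use px py in \<open>auto simp: Map.graph_def D'_def split: option.splits\<close>)
      with Dsw[rule_format, OF px py sw] show False
        by (simp add: MOST_iff_finiteNeg)
    qed
    then consider "near x (\<lambda>_. {}) y" | "near y (\<lambda>_. {}) x"
      using compat switch_iff by blast
    then show "c \<in> V \<or> d \<in> U"
    proof cases
      case 1
      then have "d \<in> nbhd K (r c) (H c U)"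
        using interp[OF zx(1) zy(1)] xy bar_mem_nbhd unfolding x_def by metis
      with H[OF U] show ?thesis by blast
    next
      case 2
      then have "c \<in> nbhd K (r d) (H d V)"
        using interp[OF zy(1) zx(1)] xy bar_mem_nbhd unfolding y_def by metis
      with H[OF V] show ?thesis by blast
    qed
  qed
qed

section \<open>Spreading over the even numbers\<close>

definition spread :: "(nat \<rightharpoonup> 'a) \<Rightarrow> (nat \<rightharpoonup> 'a)" where
  "spread x m = (if even m then x (m div 2) else None)"

lemma infinite_odd: "infinite {n::nat. odd n}"
proof -
  have "range (\<lambda>n. 2 * n + 1) \<subseteq> {n::nat. odd n}"
    by auto
  moreover have "infinite (range (\<lambda>n::nat. 2 * n + 1))"
    by (rule range_inj_infinite) (auto simp: inj_on_def)
  ultimately show ?thesis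
    using infinite_super by blast
qed

lemma MOST_even:
  assumes "MOST n::nat. P n"
  shows "MOST m. even m \<longrightarrow> P (m div 2)"
proof -
  have "{m. \<not> (even m \<longrightarrow> P (m div 2))} \<subseteq> (\<lambda>n. 2 * n) ` {n. \<not> P n}"
    by force
  then show ?thesis
    using assms unfolding MOST_iff_finiteNeg by (meson finite_imageI finite_subset)
qed

text \<open>At odd places both spread functions are \<open>None\<close>, so no condition arises
  there; even places correspond to \<open>n\<close> via doubling.\<close>

lemma near_spread_iff: "near (spread x) F (spread y) \<longleftrightarrow> near x (\<lambda>n. F (2 * n)) y"
proof
  assume "near x (\<lambda>n. F (2 * n)) y"
  from MOST_even[OF this[unfolded near_def]] show "near (spread x) F (spread y)"
    unfolding near_def by eventually_elim (auto simp: spread_def split: option.splits)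
next
  assume "near (spread x) F (spread y)"
  then have "MOST n. case spread x (2 * n) of Some a \<Rightarrow> spread y (2 * n) = Some a
      | None \<Rightarrow> spread y (2 * n) \<notin> Some ` F (2 * n)"
    unfolding near_def by (rule MOST_inj) (auto simp: inj_on_def)
  then show "near x (\<lambda>n. F (2 * n)) y"
    by (simp add: near_def spread_def cong: option.case_cong)
qed

lemma spread_partial_funs: "x \<in> partial_funs K \<Longrightarrow> spread x \<in> partial_funs K"
  by (auto simp: partial_funs_def ran_def spread_def split: if_splits)

text \<open>The odd numbers make the domain co-infinite even if \<open>dom x\<close> is cofinite, as
  can happen for a union of two proper functions.\<close>

lemma spread_proper_partial_funs:
  assumes "x \<in> partial_funs K" "infinite (dom x)"
  shows "spread x \<in> proper_partial_funs K"
proof -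
  have "(\<lambda>n. 2 * n) ` dom x \<subseteq> dom (spread x)"
    by (auto simp: spread_def)
  moreover have "infinite ((\<lambda>n. 2 * n) ` dom x)"
    using assms(2) by (simp add: finite_image_iff inj_on_def)
  moreover have "{n. odd n} \<subseteq> - dom (spread x)"
    by (auto simp: spread_def)
  ultimately show ?thesis
    using assms(1) infinite_odd spread_partial_funs finite_subset
    unfolding proper_partial_funs_def by blast
qed

section \<open>From halvability back to \<Delta>\<close>

text \<open>The parameter \<open>P\<close> treats both spaces at once: proper functions give
  \<open>nabla_star K\<close>, all partial functions give the whole nabla product.\<close>

lemma halvable_imp_Delta_A:
  fixes K :: "'a set"
  assumes "proper_partial_funs K \<subseteq> P" "P \<subseteq> partial_funs K"
    and halv: "halvable (subtopology (nabla_space (A_space K)) (bar K ` P))"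
  shows "Delta_A K"
proof -
  let ?N = "nabla_space (A_space K)"
  let ?X = "subtopology ?N (bar K ` P)"
  have top: "topspace ?X = bar K ` P"
    using assms(2) by (auto simp: topspace_nabla)
  \<comment> \<open>The union over all representatives in \<open>P\<close> makes \<open>T\<close> a
    function of the class; they differ at finitely many \<open>n\<close>, so each gives the same
    neighbourhood.\<close>
  define T :: "(nat \<Rightarrow> 'a option) set \<Rightarrow> (nat \<Rightarrow> 'a option) set set"
    where "T c = (\<Union>x\<in>{x \<in> P. c = bar K x}. nbhd K x (\<lambda>_. {})) \<inter> bar K ` P" for c
  have T: "bar K z \<in> T (bar K x) \<longleftrightarrow> near x (\<lambda>_. {}) z" if "x \<in> P" "z \<in> P" for x z
  proof -
    have "near x (\<lambda>_. {}) z" if "x' \<in> P" "bar K x = bar K x'" "near x' (\<lambda>_. {}) z" for x'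
    proof -
      have "MOST n. x n = x' n"
        using bar_eq_iff that \<open>x \<in> P\<close> assms(2) by blast
      then show ?thesis
        using that(3) unfolding near_def by eventually_elim auto
    qed
    then show ?thesis
      using that assms(2) bar_mem_nbhd[of z K] unfolding T_def by blast
  qed
  have "neighbornet ?X T"
    unfolding neighbornet_def top
  proof (intro ballI conjI)
    fix c assume "c \<in> bar K ` P"
    then obtain x where x: "x \<in> P" "c = bar K x"
      by blast
    show "T c \<subseteq> bar K ` P"
      by (auto simp: T_def)
    have "openin ?X (nbhd K x (\<lambda>_. {}) \<inter> bar K ` P)"
      by (intro openin_subtopology_Int openin_nbhd) simp
    moreover have "c \<in> nbhd K x (\<lambda>_. {}) \<inter> bar K ` P"
      using x assms(2) bar_mem_nbhd near_refl by blast
    moreover have "nbhd K x (\<lambda>_. {}) \<inter> bar K ` P \<subseteq> T c"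
      using x by (auto simp: T_def)
    ultimately show "\<exists>U. openin ?X U \<and> c \<in> U \<and> U \<subseteq> T c"
      by blast
  qed
  with halv obtain S where S: "neighbornet ?X S"
    and sep: "\<And>c d. c \<in> bar K ` P \<Longrightarrow> d \<in> bar K ` P \<Longrightarrow> S c \<inter> S d \<noteq> {} \<Longrightarrow> c \<in> T d \<or> d \<in> T c"
    unfolding halvable_def top by blast
  have "\<exists>F. (\<forall>n. F n \<in> Fpow K) \<and> nbhd K x F \<inter> bar K ` P \<subseteq> S (bar K x)" if x: "x \<in> P" for x
  proof -
    obtain W where W: "openin ?N W" "bar K x \<in> W" "W \<inter> bar K ` P \<subseteq> S (bar K x)"
    proof -
      obtain V where "openin ?X V" "bar K x \<in> V" "V \<subseteq> S (bar K x)"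
        using S imageI[OF x, of "bar K"] unfolding neighbornet_def top by meson
      moreover from this(1) obtain W where "openin ?N W" "V = W \<inter> bar K ` P"
        unfolding openin_subtopology by (elim exE conjE) (rule that)
      ultimately show ?thesis
        using that[of W] by blast
    qed
    obtain F where "\<forall>n. F n \<in> Fpow K" "nbhd K x F \<subseteq> W"
      using nbhd_base[OF W(1) _ W(2)] x assms(2) by blast
    with W(3) show ?thesis
      by blast
  qed
  then obtain F where F: "\<And>x. x \<in> P \<Longrightarrow> (\<forall>n. F x n \<in> Fpow K) \<and> nbhd K x (F x) \<inter> bar K ` P \<subseteq> S (bar K x)"
    by metis
  have spread: "spread x \<in> P" if "x \<in> partial_funs K" "infinite (dom x)" for x
    using that spread_proper_partial_funs assms(1) by blast
  show ?thesis
    unfolding Delta_A_def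
  \<comment> \<open>Place \<open>n\<close> of \<open>x\<close> becomes place \<open>2 * n\<close> of
    \<open>spread x\<close>, so the sets are read off there.\<close>
  proof (intro bexI[of _ "\<lambda>x n. F (spread x) (2 * n)"] ballI impI notI)
    show "(\<lambda>x n. F (spread x) (2 * n)) \<in> proper_partial_funs K \<rightarrow> UNIV \<rightarrow> Fpow K"
      using F spread by (auto simp: proper_partial_funs_def)
    fix x y assume x: "x \<in> proper_partial_funs K" and y: "y \<in> proper_partial_funs K"
      and sw: "switch x y"
      and fin: "finite {n. (\<exists>a. (n, a) \<in> Map.graph x - Map.graph y \<and> a \<in> F (spread y) (2 * n)) \<or>
                     (\<exists>a. (n, a) \<in> Map.graph y - Map.graph x \<and> a \<in> F (spread x) (2 * n))}"
    have sx: "spread x \<in> P" and sy: "spread y \<in> P"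
      using x y spread by (auto simp: proper_partial_funs_def)
    \<comment> \<open>The union of \<open>x\<close> and \<open>y\<close>; at the finitely many
      conflicts \<open>y\<close> wins, which does not affect nearness.\<close>
    define z where "z = x ++ y"
    have z: "spread z \<in> P"
    proof (rule spread)
      show "z \<in> partial_funs K"
        using x y
        by (auto simp: z_def proper_partial_funs_def partial_funs_def ran_def map_add_Some_iff)
      show "infinite (dom z)"
        using x by (simp add: z_def proper_partial_funs_def)
    qed
    from fin have ae: "MOST n. \<not> ((\<exists>a. (n, a) \<in> Map.graph x - Map.graph y \<and> a \<in> F (spread y) (2 * n)) \<or>
                     (\<exists>a. (n, a) \<in> Map.graph y - Map.graph x \<and> a \<in> F (spread x) (2 * n)))"
      by (simp add: MOST_iff_finiteNeg)
    have compat: "MOST n. n \<in> dom x \<inter> dom y \<longrightarrow> x n = y n"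
      using sw by (simp add: switch_iff)
    \<comment> \<open>Outside \<open>dom x\<close>, a value of \<open>z\<close> comes from
      \<open>y\<close> and not from \<open>x\<close>, so \<open>ae\<close> keeps it out of
      \<open>F (spread x) (2 * n)\<close> for almost all \<open>n\<close>.\<close>
    have "near x (\<lambda>n. F (spread x) (2 * n)) z"
      using ae compat unfolding near_def
      by eventually_elim (auto simp: z_def map_add_def Map.graph_def split: option.splits)
    moreover have "near y (\<lambda>n. F (spread y) (2 * n)) z"
      using ae compat unfolding near_def
      by eventually_elim (auto simp: z_def map_add_def Map.graph_def split: option.splits)
    ultimately have "bar K (spread z) \<in> nbhd K (spread x) (F (spread x)) \<inter> nbhd K (spread y) (F (spread y))"
      using z assms(2) by (simp add: subset_iff bar_mem_nbhd near_spread_iff)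
    then have "S (bar K (spread x)) \<inter> S (bar K (spread y)) \<noteq> {}"
      using F[OF sx] F[OF sy] z by blast
    with sep sx sy have "bar K (spread x) \<in> T (bar K (spread y)) \<or> bar K (spread y) \<in> T (bar K (spread x))"
      by blast
    then have "near x (\<lambda>_. {}) y \<or> near y (\<lambda>_. {}) x"
      using T[OF sx sy] T[OF sy sx] by (auto simp: near_spread_iff)
    with sw show False
      by (simp add: switch_iff)
  qed
qed

theorem theorem24:
  fixes K :: "'a set"
  shows "(Delta_A K \<longleftrightarrow> monotonically_normal (nabla_space (A_space K))) \<and>
    (monotonically_normal (nabla_space (A_space K)) \<longleftrightarrow> monotonically_normal (nabla_star K)) \<and>
    (monotonically_normal (nabla_star K) \<longleftrightarrow> halvable (nabla_space (A_space K)))"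
proof -
  let ?N = "nabla_space (A_space K)"
  have bc: "monotonically_normal ?N \<Longrightarrow> monotonically_normal (nabla_star K)"
    unfolding nabla_star_def by (rule monotonically_normal_subtopology)
  have ca: "Delta_A K" if "monotonically_normal (nabla_star K)"
    using halvable_imp_Delta_A[OF order_refl proper_partial_funs_subset]
      monotonically_normal_imp_halvable[OF that] unfolding nabla_star_def .
  have "subtopology ?N (bar K ` partial_funs K) = ?N"
    by (metis subtopology_topspace topspace_nabla)
  then have da: "halvable ?N \<Longrightarrow> Delta_A K"
    using halvable_imp_Delta_A[of K "partial_funs K", OF proper_partial_funs_subset order_refl] by simp
  \<comment> \<open>Two cycles close: (a) to (b) to (c) to (a), and (a) to (b) to (d) to
    (a).\<close>
  show ?thesis
    using Delta_A_imp_monotonically_normal monotonically_normal_imp_halvable bc ca da by blast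
qed

end
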